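(* For every pure integer linear program $\mathbf{PILP}$ $$\max\ z(\mathbf{x})=\mathbf{c}^{\mathrm T}\mathbf{x}+h\quad\text{s.t.}\quad \mathbf{A}\mathbf{x}\le \mathbf{b},\ \mathbf{x}\in\mathbb{Z}_+^n,$$ with $n\ge 1$, $\mathbf{c}\in\mathbb{Z}^n$, $h\in\mathbb{Z}$, $\mathbf{A}\in\mathbb{Q}^{m\times n}$, $\mathbf{b}\in\mathbb{Q}^m$, and with bounded LP-relaxation feasible region $\{\mathbf{x}\in\mathbb{R}_+^n:\mathbf{A}\mathbf{x}\le\mathbf{b}\}$, the PSA-pilp algorithm (the procedure Main together with its subroutine Inspect_Level, described in the context) terminates after a finite number of steps, and it returns an optimal solution of $\mathbf{PILP}$ if $\mathbf{PILP}$ has a feasible solution, and returns that $\mathbf{PILP}$ is infeasible otherwise. This holds whatever criteria are used for the choices left open in Inspect_Level.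
   Context: Notation: $\mathbb{Z}_+$, $\mathbb{R}_+$ are the non-negative integers and reals. A feasible solution of $\mathbf{PILP}$ is an $\mathbf{x}\in\mathbb{Z}_+^n$ with $\mathbf{A}\mathbf{x}\le\mathbf{b}$. It is assumed that a procedure is available which computes the projections defined below, for every pure integer linear program, in finitely many operations (each such computation counts as finitely many steps). Projections. For a pure integer linear program in variables $x_1,\dots,x_n$ with data $\mathbf{c},h,\mathbf{A},\mathbf{b}$, let $S=\{\mathbf{x}\in\mathbb{R}_+^n:\mathbf{A}\mathbf{x}\le\mathbf{b}\}$ be the feasible region of its LP-relaxation. For each $j$ let $l_j=\min\{x_j:\mathbf{x}\in S\}$, $u_j=\max\{x_j:\mathbf{x}\in S\}$, and for $\lambda\in[l_j,u_j]$ let $P_j^{low}(\lambda)=\min\{\mathbf{c}^{\mathrm T}\mathbf{x}+h:\mathbf{x}\in S,\ x_j=\lambda\}$ and $P_j^{up}(\lambda)=\max\{\mathbf{c}^{\mathrm T}\mathbf{x}+h:\mathbf{x}\in S,\ x_j=\lambda\}$. The projection with respect to $x_j$ is $$\mathbf{P}_j=\{(x_j,z)\in\mathbb{R}^2: x_j\in[l_j,u_j],\ P_j^{low}(x_j)\le z\le P_j^{up}(x_j)\},$$ with $\mathbf{P}_j=\emptyset$ if $S=\emptyset$. For a level $z\in\mathbb{Z}$, $Range_j^z=\{r\in\mathbb{Z}:(r,z)\in\mathbf{P}_j\}$. Levels. $cod(z(\mathbf{x}))$ is the finite set of integers lying between the minimum and the maximum of $z(\mathbf{x})$ over the feasible region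 of the LP-relaxation of $\mathbf{PILP}$. If it is empty, the algorithm returns that $\mathbf{PILP}$ is infeasible. Partial candidate solutions and reduced problems. A partial candidate solution $\bar{\mathbf{x}}=(\bar x_1,\dots,\bar x_n)$ has some components fixed to integers and the others equal to NULL (non-fixed). With $F$ the set of indices of fixed components, the reduced problem $\mathbf{PILP}|_{\bar{\mathbf{x}}}$ is the pure integer linear program obtained by imposing $x_j=\bar x_j$ for $j\in F$: in the non-negative integer variables $x_j$, $j\notin F$, maximize $\sum_{j\notin F}c_jx_j+h+\sum_{j\in F}c_j\bar x_j$ subject to $\sum_{j\notin F}a_{ij}x_j\le b_i-\sum_{j\in F}a_{ij}\bar x_j$ for all $i$. Algorithm Main (input $\mathbf{PILP}$). Step 0. Compute $\mathbf{P}_j$ for $j=1,\dots,n$ and $cod(z(\mathbf{x}))$. Set $z$ to the largest element of $cod(z(\mathbf{x}))$, $z^{best}$ to its smallest element, and $\bar{\mathbf{x}}^{best}=$ NULL. Step 1. While $z>z^{best}$, or ($z=z^{best}$ and $\bar{\mathbf{x}}^{best}=$ NULL), do: (1.1) set $\mathbf{CS}_z=$ Inspect_Level$(\mathbf{PILP},z,\{\mathbf{P}_j\}_{j=1,\dots,n})$; (1.2) for each $\bar{\mathbf{x}}\in\mathbf{CS}_z$: if $\bar{\mathbf{x}}$ is a feasible solution of $\mathbf{PILP}$ and $z(\bar{\mathbf{x}})=z$, stop and return $\bar{\mathbf{x}}$ as an optimal solution; else if $\bar{\mathbf{x}}$ is feasible and $z(\bar{\mathbf{x}})>z^{best}$,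 set $z^{best}=z(\bar{\mathbf{x}})$ and $\bar{\mathbf{x}}^{best}=\bar{\mathbf{x}}$; (1.3) set $z=z-1$. Step 2. If $\bar{\mathbf{x}}^{best}\neq$ NULL, return $\bar{\mathbf{x}}^{best}$ as an optimal solution; otherwise return that $\mathbf{PILP}$ is infeasible. Algorithm Inspect_Level (input $\mathbf{PILP}$, level $z$, projections $\{\mathbf{P}_j\}_{j=1,\dots,n}$; output a set $\mathbf{CS}_z$ of candidate solutions). Step 0. Set $\mathbf{Prob}=\mathbf{PILP}$, $\mathbf{AV}=\{x_1,\dots,x_n\}$ (active variables), with current projections the given ones; $\mathbf{CS}_z=\emptyset$; $\bar x_j=$ NULL for all $j$; $\mathbf{L}=\emptyset$. Step 1. Compute $Range_j^z$ from the current projections (those of $\mathbf{Prob}$) for all $j$ with $x_j\in\mathbf{AV}$. (a) If some $x_j\in\mathbf{AV}$ has $Range_j^z=\emptyset$, go to Step 2. (b) Otherwise, if some $x_j\in\mathbf{AV}$ has $|Range_j^z|=1$: for every $j$ with $x_j\in\mathbf{AV}$ and $Range_j^z=\{r_j\}$ a singleton, set $\bar x_j=r_j$ and remove $x_j$ from $\mathbf{AV}$. If now $\mathbf{AV}=\emptyset$, add $\bar{\mathbf{x}}$ to $\mathbf{CS}_z$ and go to Step 2; otherwise set $\mathbf{Prob}=\mathbf{PILP}|_{\bar{\mathbf{x}}}$, compute the projections $\mathbf{P}_j$ of $\mathbf{Prob}$ for all $x_j\in\mathbf{AV}$, and go to Step 1. (c) Otherwise ($|Range_j^z|>1$ for all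 $x_j\in\mathbf{AV}$): choose some $x_j\in\mathbf{AV}$ by any criterion. For each $r\in Range_j^z$, form the copy of $\bar{\mathbf{x}}$ with $\bar x_j=r$; add all these copies to $\mathbf{CS}_z$ if $|\mathbf{AV}|=1$, and to $\mathbf{L}$ if $|\mathbf{AV}|>1$. Go to Step 2. Step 2. If $\mathbf{L}\neq\emptyset$: choose $\bar{\mathbf{x}}\in\mathbf{L}$ by any criterion, remove it from $\mathbf{L}$, set $\mathbf{AV}$ to the set of variables corresponding to its non-fixed components, set $\mathbf{Prob}=\mathbf{PILP}|_{\bar{\mathbf{x}}}$, compute the projections $\mathbf{P}_j$ of $\mathbf{Prob}$ for all $x_j\in\mathbf{AV}$, and go to Step 1. If $\mathbf{L}=\emptyset$, return $\mathbf{CS}_z$. *)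

theory Defs
  imports "HOL-Analysis.Analysis"
begin

(* Problems are indexed by finite types: n = CARD('n) and m = CARD('m).  A reduced problem lives on a
   subset `vars' of the variables; data belonging to other variables is ignored, and points of the
   reduced space are embedded in the full space by zeros.  (Types are nonempty, so n >= 1 and m >= 1;
   m = 0 is void for a problem with bounded relaxation, since then the relaxation is the whole
   nonnegative orthant.) *)
record ('n::finite, 'm::finite) pilp =
  vars :: "'n set"
  cost :: "int ^ 'n"
  offset :: int
  coeffs :: "rat ^ 'n ^ 'm"
  rhs :: "rat ^ 'm"

definition pilp_of ::
  "int ^ 'n \<Rightarrow> int \<Rightarrow> rat ^ 'n ^ 'm \<Rightarrow> rat ^ 'm \<Rightarrow> ('n::finite, 'm::finite) pilp" where
  "pilp_of c h A b = \<lparr>vars = UNIV, cost = c, offset = h, coeffs = A, rhs = b\<rparr>"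

definition relaxation :: "('n::finite, 'm::finite) pilp \<Rightarrow> (real ^ 'n) set" where
  "relaxation P =
    {x. (\<forall>j\<in>vars P. 0 \<le> x $ j) \<and> (\<forall>j. j \<notin> vars P \<longrightarrow> x $ j = 0) \<and>
        (\<forall>i. (\<Sum>j\<in>vars P. of_rat (coeffs P $ i $ j) * x $ j) \<le> of_rat (rhs P $ i))}"

definition feasible :: "('n::finite, 'm::finite) pilp \<Rightarrow> int ^ 'n \<Rightarrow> bool" where
  "feasible P x \<longleftrightarrow>
    (\<forall>j\<in>vars P. 0 \<le> x $ j) \<and> (\<forall>j. j \<notin> vars P \<longrightarrow> x $ j = 0) \<and>
    (\<forall>i. (\<Sum>j\<in>vars P. coeffs P $ i $ j * of_int (x $ j)) \<le> rhs P $ i)"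

(* Polymorphic, to be used at int (feasible solutions) and at real (relaxation). *)
definition objective :: "('n::finite, 'm::finite) pilp \<Rightarrow> 'a::ring_1 ^ 'n \<Rightarrow> 'a" where
  "objective P x = (\<Sum>j\<in>vars P. of_int (cost P $ j) * x $ j) + of_int (offset P)"

definition optimal :: "('n::finite, 'm::finite) pilp \<Rightarrow> int ^ 'n \<Rightarrow> bool" where
  "optimal P x \<longleftrightarrow> feasible P x \<and> (\<forall>y. feasible P y \<longrightarrow> objective P y \<le> objective P x)"

(* The minima and maxima below are honest ones: LEAST and GREATEST are only meaningful when attained,
   which is the case for a bounded nonempty relaxation. *)

definition var_min :: "('n::finite, 'm::finite) pilp \<Rightarrow> 'n \<Rightarrow> real" where
  "var_min P j = (LEAST t. t \<in> (\<lambda>x. x $ j) ` relaxation P)"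

definition var_max :: "('n::finite, 'm::finite) pilp \<Rightarrow> 'n \<Rightarrow> real" where
  "var_max P j = (GREATEST t. t \<in> (\<lambda>x. x $ j) ` relaxation P)"

definition proj_low :: "('n::finite, 'm::finite) pilp \<Rightarrow> 'n \<Rightarrow> real \<Rightarrow> real" where
  "proj_low P j t = (LEAST v. v \<in> objective P ` {x \<in> relaxation P. x $ j = t})"

definition proj_up :: "('n::finite, 'm::finite) pilp \<Rightarrow> 'n \<Rightarrow> real \<Rightarrow> real" where
  "proj_up P j t = (GREATEST v. v \<in> objective P ` {x \<in> relaxation P. x $ j = t})"

definition projection :: "('n::finite, 'm::finite) pilp \<Rightarrow> 'n \<Rightarrow> (real \<times> real) set" where
  "projection P j =
    (if relaxation P = {} then {}
     else {(t, v). var_min P j \<le> t \<and> t \<le> var_max P j \<and> proj_low P j t \<le> v \<and> v \<le> proj_up P j t})"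

definition level_range :: "int \<Rightarrow> (real \<times> real) set \<Rightarrow> int set" where
  "level_range z Q = {r. (real_of_int r, real_of_int z) \<in> Q}"

definition cod :: "('n::finite, 'm::finite) pilp \<Rightarrow> int set" where
  "cod P =
    (if relaxation P = {} then {}
     else {k. (LEAST v. v \<in> objective P ` relaxation P) \<le> real_of_int k \<and>
              real_of_int k \<le> (GREATEST v. v \<in> objective P ` relaxation P)})"

(* A partial candidate maps each variable to its fixed value, or to None (NULL). *)
type_synonym 'n candidate = "'n \<rightharpoonup> int"

definition reduced ::
  "('n::finite, 'm::finite) pilp \<Rightarrow> 'n candidate \<Rightarrow> ('n, 'm) pilp" where
  "reduced P xb = P\<lparr>
     vars := vars P - dom xb,
     offset := offset P + (\<Sum>j\<in>dom xb. cost P $ j * the (xb j)),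
     rhs := (\<chi> i. rhs P $ i - (\<Sum>j\<in>dom xb. coeffs P $ i $ j * of_int (the (xb j))))\<rparr>"

definition point :: "'n::finite candidate \<Rightarrow> int ^ 'n" where
  "point xb = (\<chi> j. the (xb j))"

definition feasible_candidate :: "('n::finite, 'm::finite) pilp \<Rightarrow> 'n candidate \<Rightarrow> bool" where
  "feasible_candidate P xb \<longleftrightarrow> dom xb = UNIV \<and> feasible P (point xb)"

(* The algorithms are small-step transition relations; nondeterminism covers every choice criterion
   (including history-dependent ones) and every order in which a "for each" loop visits its set.
   The loops over ranges and candidate sets are run element by element, so that looping over an
   infinite set would not count as terminating.

   Control points of Inspect_Level:
     Step1 Pj AV xb CS L     with Pj the current projections (those of the current Prob),
     Branch AV xb j R CS L   the loop of case (c) on the variable j, R being the values still to do,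
     Step2 CS L,
     Done CS                 returning CS. *)
datatype 'n inspect_state =
    Step1 "'n \<Rightarrow> (real \<times> real) set" "'n set" "'n candidate" "'n candidate set" "'n candidate set"
  | Branch "'n set" "'n candidate" 'n "int set" "'n candidate set" "'n candidate set"
  | Step2 "'n candidate set" "'n candidate set"
  | Done "'n candidate set"

definition inspect_start ::
  "('n::finite, 'm::finite) pilp \<Rightarrow> ('n \<Rightarrow> (real \<times> real) set) \<Rightarrow> 'n inspect_state" where
  "inspect_start P Pj = Step1 Pj (vars P) (\<lambda>_. None) {} {}"

definition singles :: "int \<Rightarrow> ('n \<Rightarrow> (real \<times> real) set) \<Rightarrow> 'n set \<Rightarrow> 'n set" where
  "singles z Pj AV = {j \<in> AV. card (level_range z (Pj j)) = 1}"

definition fix_singles ::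
  "int \<Rightarrow> ('n \<Rightarrow> (real \<times> real) set) \<Rightarrow> 'n set \<Rightarrow> 'n candidate \<Rightarrow> 'n candidate" where
  "fix_singles z Pj AV xb =
    (\<lambda>j. if j \<in> singles z Pj AV then Some (the_elem (level_range z (Pj j))) else xb j)"

inductive inspect_step ::
  "('n::finite, 'm::finite) pilp \<Rightarrow> int \<Rightarrow> 'n inspect_state \<Rightarrow> 'n inspect_state \<Rightarrow> bool"
  for P z where
  empty_range:
    "\<lbrakk>j \<in> AV; level_range z (Pj j) = {}\<rbrakk> \<Longrightarrow>
     inspect_step P z (Step1 Pj AV xb CS L) (Step2 CS L)"
| fix_all:
    "\<lbrakk>\<forall>j\<in>AV. level_range z (Pj j) \<noteq> {}; singles z Pj AV \<noteq> {}; AV - singles z Pj AV = {}\<rbrakk> \<Longrightarrow>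
     inspect_step P z (Step1 Pj AV xb CS L) (Step2 (insert (fix_singles z Pj AV xb) CS) L)"
| fix_some:
    "\<lbrakk>\<forall>j\<in>AV. level_range z (Pj j) \<noteq> {}; singles z Pj AV \<noteq> {}; AV - singles z Pj AV \<noteq> {};
      xb' = fix_singles z Pj AV xb\<rbrakk> \<Longrightarrow>
     inspect_step P z (Step1 Pj AV xb CS L)
       (Step1 (projection (reduced P xb')) (AV - singles z Pj AV) xb' CS L)"
| branch:
    "\<lbrakk>\<forall>j\<in>AV. level_range z (Pj j) \<noteq> {}; singles z Pj AV = {}; j \<in> AV\<rbrakk> \<Longrightarrow>
     inspect_step P z (Step1 Pj AV xb CS L) (Branch AV xb j (level_range z (Pj j)) CS L)"
| branch_last:
    "\<lbrakk>r \<in> R; card AV = 1\<rbrakk> \<Longrightarrow>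
     inspect_step P z (Branch AV xb j R CS L) (Branch AV xb j (R - {r}) (insert (xb(j \<mapsto> r)) CS) L)"
| branch_more:
    "\<lbrakk>r \<in> R; card AV > 1\<rbrakk> \<Longrightarrow>
     inspect_step P z (Branch AV xb j R CS L) (Branch AV xb j (R - {r}) CS (insert (xb(j \<mapsto> r)) L))"
| branch_end:
    "inspect_step P z (Branch AV xb j {} CS L) (Step2 CS L)"
| pop:
    "xb \<in> L \<Longrightarrow>
     inspect_step P z (Step2 CS L)
       (Step1 (projection (reduced P xb)) (vars P - dom xb) xb CS (L - {xb}))"
| finish:
    "inspect_step P z (Step2 CS {}) (Done CS)"

datatype 'n outcome = Optimal "int ^ 'n" | Infeasible

(* In Loop, Inspecting and Checking the first four arguments are the variables of Main: the projections
   of the input problem, z, z^best and xbar^best (None for NULL).  The last argument of Checking is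
   the set of candidates of CS_z not yet examined. *)
datatype 'n main_state =
    Start
  | Loop "'n \<Rightarrow> (real \<times> real) set" int int "(int ^ 'n) option"
  | Inspecting "'n \<Rightarrow> (real \<times> real) set" int int "(int ^ 'n) option" "'n inspect_state"
  | Checking "'n \<Rightarrow> (real \<times> real) set" int int "(int ^ 'n) option" "'n candidate set"
  | Return "'n outcome"

definition continue :: "int \<Rightarrow> int \<Rightarrow> 'a option \<Rightarrow> bool" where
  "continue z zbest best \<longleftrightarrow> z > zbest \<or> (z = zbest \<and> best = None)"

inductive main_step ::
  "('n::finite, 'm::finite) pilp \<Rightarrow> 'n main_state \<Rightarrow> 'n main_state \<Rightarrow> bool"
  for P where
  start_empty:
    "cod P = {} \<Longrightarrow> main_step P Start (Return Infeasible)"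
| start:
    "cod P \<noteq> {} \<Longrightarrow> main_step P Start (Loop (projection P) (Max (cod P)) (Min (cod P)) None)"
| call:
    "continue z zbest best \<Longrightarrow>
     main_step P (Loop Pj z zbest best) (Inspecting Pj z zbest best (inspect_start P Pj))"
| inspect:
    "inspect_step P z s s' \<Longrightarrow>
     main_step P (Inspecting Pj z zbest best s) (Inspecting Pj z zbest best s')"
| inspected:
    "main_step P (Inspecting Pj z zbest best (Done CS)) (Checking Pj z zbest best CS)"
| check_hit:
    "\<lbrakk>xb \<in> K; feasible_candidate P xb; objective P (point xb) = z\<rbrakk> \<Longrightarrow>
     main_step P (Checking Pj z zbest best K) (Return (Optimal (point xb)))"
| check_improve:
    "\<lbrakk>xb \<in> K; feasible_candidate P xb; objective P (point xb) \<noteq> z; objective P (point xb) > zbest\<rbrakk> \<Longrightarrow>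
     main_step P (Checking Pj z zbest best K)
       (Checking Pj z (objective P (point xb)) (Some (point xb)) (K - {xb}))"
| check_skip:
    "\<lbrakk>xb \<in> K;
      \<not> (feasible_candidate P xb \<and> (objective P (point xb) = z \<or> objective P (point xb) > zbest))\<rbrakk> \<Longrightarrow>
     main_step P (Checking Pj z zbest best K) (Checking Pj z zbest best (K - {xb}))"
| next_level:
    "main_step P (Checking Pj z zbest best {}) (Loop Pj (z - 1) zbest best)"
| return_best:
    "\<lbrakk>\<not> continue z zbest best; best = Some x\<rbrakk> \<Longrightarrow>
     main_step P (Loop Pj z zbest best) (Return (Optimal x))"
| return_infeasible:
    "\<lbrakk>\<not> continue z zbest best; best = None\<rbrakk> \<Longrightarrow>
     main_step P (Loop Pj z zbest best) (Return Infeasible)"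

end

theory Submission
  imports Defs "HOL-Library.Multiset_Order"
begin

text \<open>
  Completeness rests on one observation about the projections.  If a feasible solution \<open>x\<close> with
  \<open>z(x) = z\<close> extends a partial candidate \<open>xb\<close>, then \<open>x\<close> with its fixed components zeroed lies in the
  relaxation of the reduced problem and has objective value \<open>z\<close> there, so \<open>x\<^sub>j\<close> belongs to the level
  range of every active variable \<open>j\<close> (\<open>solution_in_range\<close>).  Hence pruning on an empty range loses no
  solution of level \<open>z\<close>, fixing a singleton range is forced, and branching over a range is exhaustive:
  at every moment of Inspect_Level each solution of level \<open>z\<close> either is already collected or extends
  some pending partial candidate (\<open>inspect_inv\<close>).  When nothing is pending, all of them are collected.

  Main visits the levels from the maximum of \<open>cod\<close> downwards.  On reaching a level \<open>z\<close> it
  has excluded feasible solutions of larger value, so a hit at level \<open>z\<close> is optimal, and so is an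
  incumbent as soon as its value is at least \<open>z\<close>.  Since every feasible value is in \<open>cod\<close>, running
  past the minimum of \<open>cod\<close> without an incumbent proves infeasibility.

  The extrema that define a projection only carry information when they are attained, which
  needs every reduced problem to have a bounded relaxation.  This holds as long as the fixed values are
  nonnegative: the reduced relaxation is then a translate of a slice of the original one
  (\<open>bounded_reduced\<close>).  Values taken from a range are nonnegative, so the condition propagates.

  As for termination, every range lies between two real numbers and is finite.  Inspect_Level replaces a
  node by finitely many nodes with fewer free variables, so a multiset of node weights
  decreases; over the whole run, a lexicographic combination of the level, the phase
  and this multiset does (\<open>main_step_decreases\<close>).  Finally, no state other than a returning one is stuck,
  because a pending node always has a free variable (\<open>inspect_progress\<close>, \<open>main_progress\<close>).
\<close>

section \<open>Attained extrema over the relaxation\<close>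

lemma closed_relaxation: "closed (relaxation Q)"
proof -
  have "closed {x :: real ^ 'a. j \<in> vars Q \<longrightarrow> 0 \<le> x $ j}" for j :: 'a
    by (cases "j \<in> vars Q") (auto intro!: closed_Collect_le continuous_intros)
  moreover have "closed {x :: real ^ 'a. j \<notin> vars Q \<longrightarrow> x $ j = 0}" for j :: 'a
    by (cases "j \<in> vars Q") (auto intro!: closed_Collect_eq continuous_intros)
  ultimately show ?thesis
    unfolding relaxation_def Ball_def
    by (intro closed_Collect_conj closed_Collect_all closed_Collect_le continuous_intros)
qed

lemma continuous_on_objective:
  "continuous_on S (objective Q :: real ^ 'n::finite \<Rightarrow> real)"
  unfolding objective_def [abs_def] by (intro continuous_intros)

text \<open>
  The extrema in the definitions of the projections are given by \<open>LEAST\<close> and \<open>GREATEST\<close>, about which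
  nothing is known unless they are attained.  Compactness supplies attainment.
\<close>

lemma Least_image_le:
  fixes f :: "'a::topological_space \<Rightarrow> real"
  assumes "compact S" "continuous_on S f" "x \<in> S"
  shows "(LEAST v. v \<in> f ` S) \<le> f x"
proof -
  obtain y where "y \<in> S" "\<forall>x\<in>S. f y \<le> f x"
    using continuous_attains_inf[OF assms(1) _ assms(2)] assms(3) by blast
  then have "(LEAST v. v \<in> f ` S) = f y" by (intro Least_equality) auto
  then show ?thesis using \<open>\<forall>x\<in>S. f y \<le> f x\<close> assms(3) by simp
qed

lemma Least_image_in:
  fixes f :: "'a::topological_space \<Rightarrow> real"
  assumes "compact S" "continuous_on S f" "S \<noteq> {}"
  shows "(LEAST v. v \<in> f ` S) \<in> f ` S"
proof -
  obtain y where "y \<in> S" "\<forall>x\<in>S. f y \<le> f x"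
    using continuous_attains_inf[OF assms(1,3,2)] by blast
  then have "(LEAST v. v \<in> f ` S) = f y" by (intro Least_equality) auto
  then show ?thesis using \<open>y \<in> S\<close> by simp
qed

lemma le_Greatest_image:
  fixes f :: "'a::topological_space \<Rightarrow> real"
  assumes "compact S" "continuous_on S f" "x \<in> S"
  shows "f x \<le> (GREATEST v. v \<in> f ` S)"
proof -
  obtain y where "y \<in> S" "\<forall>x\<in>S. f x \<le> f y"
    using continuous_attains_sup[OF assms(1) _ assms(2)] assms(3) by blast
  then have "(GREATEST v. v \<in> f ` S) = f y" by (intro Greatest_equality) auto
  then show ?thesis using \<open>\<forall>x\<in>S. f x \<le> f y\<close> assms(3) by simp
qed

lemma finite_ints_between: "finite {k :: int. l \<le> real_of_int k \<and> real_of_int k \<le> u}"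
  by (rule finite_subset[of _ "{\<lceil>l\<rceil>..\<lfloor>u\<rfloor>}"]) (auto simp: ceiling_le_iff le_floor_iff)

lemma finite_cod: "finite (cod Q)"
  by (simp add: cod_def finite_ints_between)

lemma objective_in_cod:
  assumes "bounded (relaxation Q)" "y \<in> relaxation Q" "objective Q y = real_of_int k"
  shows "k \<in> cod Q"
proof -
  have "compact (relaxation Q)"
    using assms(1) closed_relaxation compact_eq_bounded_closed by blast
  from Least_image_le[OF this continuous_on_objective assms(2), of Q]
    le_Greatest_image[OF this continuous_on_objective assms(2), of Q]
  show ?thesis using assms(2,3) by (auto simp: cod_def)
qed

lemma finite_level_range: "finite (level_range z (projection Q j))"
  by (rule finite_subset[OF _ finite_ints_between[of "var_min Q j" "var_max Q j"]])
     (auto simp: level_range_def projection_def)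

text \<open>
  A range is bounded below by the least value of the coordinate, which is attained at a point of the
  relaxation and is therefore nonnegative.  This keeps the values fixed along a branch nonnegative.
\<close>

lemma level_range_nonneg:
  assumes "bounded (relaxation Q)" "j \<in> vars Q" "r \<in> level_range z (projection Q j)"
  shows "0 \<le> r"
proof -
  have "relaxation Q \<noteq> {}" and le: "var_min Q j \<le> real_of_int r"
    using assms(3) by (auto simp: level_range_def projection_def split: if_splits)
  moreover have "compact (relaxation Q)"
    using assms(1) closed_relaxation compact_eq_bounded_closed by blast
  ultimately have "var_min Q j \<in> (\<lambda>x. x $ j) ` relaxation Q"
    unfolding var_min_def by (intro Least_image_in continuous_intros)
  then have "0 \<le> var_min Q j"
    using assms(2) by (auto simp: relaxation_def)
  with le show ?thesis by simp
qed

text \<open>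
  The relaxation and each of its slices \<open>x\<^sub>j = t\<close> are compact, so the four extrema that bound the
  projection really do bound the coordinate and the objective of each of their points.
\<close>

lemma in_level_range:
  assumes "bounded (relaxation Q)" "y \<in> relaxation Q"
    and "objective Q y = real_of_int z" "y $ j = real_of_int r"
  shows "r \<in> level_range z (projection Q j)"
proof -
  have "compact (relaxation Q)"
    using assms(1) closed_relaxation compact_eq_bounded_closed by blast
  have "var_min Q j \<le> y $ j" "y $ j \<le> var_max Q j"
    unfolding var_min_def var_max_def
    by (rule Least_image_le[OF \<open>compact _\<close> _ assms(2)] le_Greatest_image[OF \<open>compact _\<close> _ assms(2)];
        intro continuous_intros)+
  moreover
  let ?S = "{x \<in> relaxation Q. x $ j = y $ j}"
  have "?S = relaxation Q \<inter> {x. x $ j = y $ j}" by auto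
  then have "compact ?S"
    using \<open>compact (relaxation Q)\<close>
    by (auto intro!: compact_Int_closed closed_Collect_eq continuous_intros)
  have "y \<in> ?S" using assms(2) by simp
  have "proj_low Q j (y $ j) \<le> objective Q y" "objective Q y \<le> proj_up Q j (y $ j)"
    unfolding proj_low_def proj_up_def
    by (rule Least_image_le[OF \<open>compact ?S\<close> continuous_on_objective \<open>y \<in> ?S\<close>]
        le_Greatest_image[OF \<open>compact ?S\<close> continuous_on_objective \<open>y \<in> ?S\<close>])+
  ultimately show ?thesis
    using assms(2,3,4) by (auto simp: level_range_def projection_def)
qed

section \<open>Reduced problems\<close>

definition full :: "int ^ 'n \<Rightarrow> 'n candidate" where
  "full x = (\<lambda>j. Some (x $ j))"

lemma point_full [simp]: "point (full x) = x"
  by (simp add: point_def full_def vec_eq_iff)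

lemma dom_full [simp]: "dom (full x) = UNIV"
  by (auto simp: full_def)

lemma map_le_full_iff: "xb \<subseteq>\<^sub>m full x \<longleftrightarrow> (\<forall>j r. xb j = Some r \<longrightarrow> r = x $ j)"
  by (auto simp: map_le_def full_def dom_def)

lemma reduced_empty [simp]: "reduced P Map.empty = P"
  by (simp add: reduced_def)

text \<open>
  Adding the fixed values, as a vector \<open>e\<close>, to a point of the reduced relaxation gives a point of the
  original one.  Nonnegativity of the fixed values matters when the original relaxation is empty: with
  the single constraint \<open>x\<^sub>1 \<le> - 1\<close>, fixing \<open>x\<^sub>1\<close> to \<open>- 1\<close> leaves the other variables unbounded.
\<close>

lemma bounded_reduced:
  assumes "bounded (relaxation P)" "dom xb \<subseteq> vars P" "\<forall>r\<in>ran xb. 0 \<le> r"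
  shows "bounded (relaxation (reduced P xb))"
proof -
  define e :: "real ^ 'a" where "e = (\<chi> j. case xb j of None \<Rightarrow> 0 | Some r \<Rightarrow> real_of_int r)"
  have e_in: "e $ j = real_of_int (the (xb j))" if "j \<in> dom xb" for j
    using that by (auto simp: e_def)
  have e_out: "e $ j = 0" if "j \<notin> dom xb" for j
    using that by (auto simp: e_def dom_def)
  have e_nonneg: "0 \<le> e $ j" for j
    using assms(3) by (auto simp: e_def ran_def split: option.split)
  have "e + y \<in> relaxation P" if y: "y \<in> relaxation (reduced P xb)" for y
  proof -
    have y_out: "y $ j = 0" if "j \<notin> vars P - dom xb" for j
      using y that by (simp add: relaxation_def reduced_def)
    have "0 \<le> y $ j" for j
      using y y_out[of j] by (cases "j \<in> vars P - dom xb") (simp_all add: relaxation_def reduced_def)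
    moreover have "(\<Sum>j\<in>vars P. of_rat (coeffs P $ i $ j) * (e + y) $ j) \<le> of_rat (rhs P $ i)" for i
    proof -
      have "(\<Sum>j\<in>vars P. of_rat (coeffs P $ i $ j) * (e + y) $ j) =
        (\<Sum>j\<in>dom xb. of_rat (coeffs P $ i $ j) * (e + y) $ j) +
        (\<Sum>j\<in>vars P - dom xb. of_rat (coeffs P $ i $ j) * (e + y) $ j)"
        using sum.subset_diff[OF assms(2)] by (simp add: add.commute)
      also have "\<dots> = (\<Sum>j\<in>dom xb. of_rat (coeffs P $ i $ j) * of_int (the (xb j))) +
        (\<Sum>j\<in>vars P - dom xb. of_rat (coeffs P $ i $ j) * y $ j)"
        by (intro arg_cong2[where f = "(+)"] sum.cong) (auto simp: e_in e_out y_out)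
      also have "\<dots> \<le> of_rat (rhs P $ i)"
        using y by (simp add: relaxation_def reduced_def of_rat_diff of_rat_sum of_rat_mult
            algebra_simps)
      finally show ?thesis .
    qed
    moreover have "(e + y) $ j = 0" if "j \<notin> vars P" for j
      using that assms(2) e_out[of j] y_out[of j] by auto
    ultimately show ?thesis
      using e_nonneg by (simp add: relaxation_def)
  qed
  then have "relaxation (reduced P xb) \<subseteq> (\<lambda>x. - e + x) ` relaxation P"
    by (force simp: image_iff intro!: bexI[of _ "e + _"])
  then show ?thesis
    using bounded_subset bounded_translation[OF assms(1)] by blast
qed

text \<open>
  In the other direction, a feasible solution that agrees with the fixed values restricts to a point
  of the reduced relaxation, because the contribution of the fixed variables has merely been moved
  into the right-hand side and the offset.
\<close>

lemma feasible_completion: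
  assumes "feasible P x" "xb \<subseteq>\<^sub>m full x" "dom xb \<subseteq> vars P"
  defines "y \<equiv> \<chi> j. if j \<in> dom xb then 0 else real_of_int (x $ j)"
  shows "y \<in> relaxation (reduced P xb)"
    and "objective (reduced P xb) y = real_of_int (objective P x)"
proof -
  have xb: "the (xb j) = x $ j" if "j \<in> dom xb" for j
    using assms(2) that by (auto simp: map_le_full_iff)
  have split: "sum f (vars P) = sum f (dom xb) + sum f (vars P - dom xb)"
    for f :: "'a \<Rightarrow> real"
    using sum.subset_diff[OF assms(3)] by (simp add: add.commute)
  have "(\<Sum>j\<in>vars P - dom xb. of_rat (coeffs P $ i $ j) * y $ j) \<le>
    of_rat (rhs P $ i - (\<Sum>j\<in>dom xb. coeffs P $ i $ j * of_int (the (xb j))))" for i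
  proof -
    have "(\<Sum>j\<in>vars P. coeffs P $ i $ j * of_int (x $ j)) \<le> rhs P $ i"
      using assms(1) by (simp add: feasible_def)
    then have "of_rat (\<Sum>j\<in>vars P. coeffs P $ i $ j * of_int (x $ j)) \<le> (of_rat (rhs P $ i) :: real)"
      by (simp only: of_rat_less_eq)
    then have "(\<Sum>j\<in>vars P. of_rat (coeffs P $ i $ j) * real_of_int (x $ j)) \<le> of_rat (rhs P $ i)"
      by (simp add: of_rat_sum of_rat_mult)
    moreover have "(\<Sum>j\<in>vars P - dom xb. of_rat (coeffs P $ i $ j) * y $ j) =
      (\<Sum>j\<in>vars P - dom xb. of_rat (coeffs P $ i $ j) * real_of_int (x $ j))"
      by (intro sum.cong) (auto simp: y_def)
    ultimately show ?thesis
      by (simp add: split xb of_rat_diff of_rat_sum of_rat_mult)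
  qed
  then show "y \<in> relaxation (reduced P xb)"
    using assms(1) by (simp add: relaxation_def reduced_def feasible_def y_def)
  have "(\<Sum>j\<in>vars P - dom xb. real_of_int (cost P $ j) * y $ j) =
    (\<Sum>j\<in>vars P - dom xb. real_of_int (cost P $ j) * real_of_int (x $ j))"
    by (intro sum.cong) (auto simp: y_def)
  then show "objective (reduced P xb) y = real_of_int (objective P x)"
    by (simp add: objective_def reduced_def split xb)
qed

section \<open>A weight for the search tree\<close>

lemma smaller_replacement_less_mset:
  fixes x :: "'a::linorder"
  shows "(\<And>y. y \<in># N \<Longrightarrow> y < x) \<Longrightarrow> N + M < add_mset x M"
  using add_strict_right_mono[of N "{#x#}" M] ex_gt_imp_less_multiset[of "{#x#}" N] by simp

text \<open>
  A node with \<open>k\<close> free variables passes through several stages, whose weights all lie between \<open>4 * k - 1\<close>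
  and \<open>4 * k + 2\<close>: waiting in \<open>L\<close> (\<open>4 * k + 2\<close>), under inspection (\<open>4 * k + 1\<close>), and being branched on
  (\<open>4 * k\<close>, with a separate \<open>4 * k - 1\<close> for each value still to be tried).  A child produced from such a
  value has \<open>k - 1\<close> free variables and enters \<open>L\<close> with weight \<open>4 * k - 2\<close>.  So each step
  drops an element of the multiset or trades it for smaller ones.
\<close>

definition node_weights :: "'n::finite candidate set \<Rightarrow> nat multiset" where
  "node_weights L = image_mset (\<lambda>xb. 4 * card (- dom xb) + 2) (mset_set L)"

text \<open>The element \<open>0\<close> is present until the level is finished, and pays for the final step.\<close>

fun inspect_weights :: "'n::finite inspect_state \<Rightarrow> nat multiset" where
  "inspect_weights (Step1 Pj AV xb CS L) = {#4 * card AV + 1, 0#} + node_weights L"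
| "inspect_weights (Branch AV xb j R CS L) =
    {#4 * card AV, 0#} + replicate_mset (card R) (4 * card AV - 1) + node_weights L"
| "inspect_weights (Step2 CS L) = {#0#} + node_weights L"
| "inspect_weights (Done CS) = {#}"

section \<open>Inspecting one level\<close>

lemma fix_singles_cases:
  assumes "fix_singles z Pj AV xb j = Some r"
  obtains "xb j = Some r" | "j \<in> AV" "level_range z (Pj j) = {r}"
proof (cases "j \<in> singles z Pj AV")
  case True
  then have "j \<in> AV" "card (level_range z (Pj j)) = 1"
    by (simp_all add: singles_def)
  then obtain s where "level_range z (Pj j) = {s}" by (metis card_1_singletonE)
  then show ?thesis using that(2) True assms \<open>j \<in> AV\<close> by (simp add: fix_singles_def)
next
  case False
  then show ?thesis using that(1) assms by (simp add: fix_singles_def)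
qed

locale bounded_pilp =
  fixes P :: "('n::finite, 'm::finite) pilp"
  assumes all_vars: "vars P = UNIV"
    and bounded_relaxation: "bounded (relaxation P)"
begin

definition solutions :: "int \<Rightarrow> (int ^ 'n) set" where
  "solutions z = {x. feasible P x \<and> objective P x = z}"

text \<open>
  What holds of every pending node: nonnegative fixed values make the reduced relaxation bounded,
  and a free variable makes some rule applicable to it.
\<close>

definition open_node :: "'n candidate \<Rightarrow> bool" where
  "open_node xb \<longleftrightarrow> (\<forall>r\<in>ran xb. 0 \<le> r) \<and> dom xb \<noteq> UNIV"

lemma open_node_bounded: "open_node xb \<Longrightarrow> bounded (relaxation (reduced P xb))"
  using bounded_reduced[OF bounded_relaxation] by (simp add: open_node_def all_vars)

lemma range_nonneg:
  assumes "open_node xb" "j \<in> - dom xb" "r \<in> level_range z (projection (reduced P xb) j)"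
  shows "0 \<le> r"
  using level_range_nonneg[OF open_node_bounded[OF assms(1)] _ assms(3)] assms(2)
  by (simp add: reduced_def all_vars)

text \<open>
  The reason why no solution of level \<open>z\<close> is ever lost: its components show up in the ranges of all
  nodes that it extends.
\<close>

lemma solution_in_range:
  assumes "open_node xb" "x \<in> solutions z" "xb \<subseteq>\<^sub>m full x" "j \<in> - dom xb"
  shows "x $ j \<in> level_range z (projection (reduced P xb) j)"
proof -
  have "feasible P x" "objective P x = z" "dom xb \<subseteq> vars P"
    using assms(2) by (simp_all add: solutions_def all_vars)
  from feasible_completion[OF this(1) assms(3) this(3)] this(2) show ?thesis
    using assms(4) by (intro in_level_range[OF open_node_bounded[OF assms(1)], rotated 2]) simp_all
qed

text \<open>
  In each state, the last conjunct says where a solution of level \<open>z\<close> can still be: collected in \<open>CS\<close>,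
  below a node of \<open>L\<close>, or below the current node.  In a branching loop, the latter only counts for
  values in \<open>R\<close>, the others having been handed over to \<open>L\<close> or \<open>CS\<close>.
\<close>

fun inspect_inv :: "int \<Rightarrow> 'n inspect_state \<Rightarrow> bool" where
  "inspect_inv z (Step1 Pj AV xb CS L) \<longleftrightarrow>
    open_node xb \<and> AV = - dom xb \<and> Pj = projection (reduced P xb) \<and>
    finite CS \<and> finite L \<and> (\<forall>xb'\<in>L. open_node xb') \<and>
    (\<forall>x\<in>solutions z. full x \<in> CS \<or> (\<exists>xb'\<in>L. xb' \<subseteq>\<^sub>m full x) \<or> xb \<subseteq>\<^sub>m full x)"
| "inspect_inv z (Branch AV xb j R CS L) \<longleftrightarrow>
    open_node xb \<and> AV = - dom xb \<and> j \<in> AV \<and> finite R \<and> (\<forall>r\<in>R. 0 \<le> r) \<and>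
    finite CS \<and> finite L \<and> (\<forall>xb'\<in>L. open_node xb') \<and>
    (\<forall>x\<in>solutions z. full x \<in> CS \<or> (\<exists>xb'\<in>L. xb' \<subseteq>\<^sub>m full x) \<or> xb \<subseteq>\<^sub>m full x \<and> x $ j \<in> R)"
| "inspect_inv z (Step2 CS L) \<longleftrightarrow>
    finite CS \<and> finite L \<and> (\<forall>xb'\<in>L. open_node xb') \<and>
    (\<forall>x\<in>solutions z. full x \<in> CS \<or> (\<exists>xb'\<in>L. xb' \<subseteq>\<^sub>m full x))"
| "inspect_inv z (Done CS) \<longleftrightarrow> finite CS \<and> (\<forall>x\<in>solutions z. full x \<in> CS)"

lemma inspect_inv_start: "inspect_inv z (inspect_start P (projection P))"
  by (simp add: inspect_start_def open_node_def all_vars)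

text \<open>
  By \<open>solution_in_range\<close>, a singleton range can only consist of the component of the solution in
  question, so fixing all singletons at once keeps every solution of level \<open>z\<close> that extends the node.
\<close>

lemma
  fixes z :: int
  assumes "open_node xb" "AV = - dom xb"
  defines "xb' \<equiv> fix_singles z (projection (reduced P xb)) AV xb"
  shows dom_fix_singles: "- dom xb' = AV - singles z (projection (reduced P xb)) AV"
    and ran_fix_singles: "r \<in> ran xb' \<Longrightarrow> 0 \<le> r"
    and fix_singles_le_solution:
      "x \<in> solutions z \<Longrightarrow> xb \<subseteq>\<^sub>m full x \<Longrightarrow> xb' \<subseteq>\<^sub>m full x"
proof -
  show "- dom xb' = AV - singles z (projection (reduced P xb)) AV"
    using assms(2) by (auto simp: xb'_def fix_singles_def singles_def split: if_splits)
  show "0 \<le> r" if r: "r \<in> ran xb'" for r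
  proof -
    obtain j where "xb' j = Some r" using r by (auto simp: ran_def)
    then show ?thesis
      unfolding xb'_def
    proof (cases rule: fix_singles_cases)
      case 1
      then show ?thesis using assms(1) by (auto simp: open_node_def ran_def)
    next
      case 2
      then show ?thesis using range_nonneg[OF assms(1)] assms(2) by blast
    qed
  qed
  show "xb' \<subseteq>\<^sub>m full x" if x: "x \<in> solutions z" "xb \<subseteq>\<^sub>m full x" for x
    unfolding map_le_full_iff
  proof (intro allI impI)
    fix j r assume "xb' j = Some r"
    then show "r = x $ j"
      unfolding xb'_def
    proof (cases rule: fix_singles_cases)
      case 1
      then show ?thesis using x(2) by (simp add: map_le_full_iff)
    next
      case 2
      then have "x $ j \<in> {r}" using solution_in_range[OF assms(1) x, of j] assms(2) by simp
      then show ?thesis by simp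
    qed
  qed
qed

lemma open_node_upd:
  assumes "open_node xb" "j \<in> - dom xb" "0 \<le> r" "1 < card (- dom xb)"
  shows "open_node (xb(j \<mapsto> r))"
proof -
  have "- dom (xb(j \<mapsto> r)) = - dom xb - {j}" by auto
  then have "card (- dom (xb(j \<mapsto> r))) > 0"
    using assms(2,4) by simp
  then have "dom (xb(j \<mapsto> r)) \<noteq> UNIV" by (metis Compl_UNIV_eq card.empty less_irrefl)
  moreover have "ran (xb(j \<mapsto> r)) = insert r (ran xb)"
    using assms(2) by (intro ran_map_upd) auto
  ultimately show ?thesis
    using assms(1,3) by (auto simp: open_node_def)
qed

lemma upd_le_full: "xb \<subseteq>\<^sub>m full x \<Longrightarrow> xb(j \<mapsto> x $ j) \<subseteq>\<^sub>m full x"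
  by (simp add: map_le_full_iff)

lemma total_le_full: "xb \<subseteq>\<^sub>m full x \<Longrightarrow> dom xb = UNIV \<Longrightarrow> xb = full x"
  by (metis dom_full map_le_antisym map_le_def)

lemma inspect_inv_step:
  assumes "inspect_step P z s s'" "inspect_inv z s"
  shows "inspect_inv z s'"
  using assms
proof cases
  case (empty_range j AV Pj xb CS L)
  have "\<not> xb \<subseteq>\<^sub>m full x" if "x \<in> solutions z" for x
    using solution_in_range[of xb x z j] that empty_range assms(2) by auto
  then show ?thesis using empty_range assms(2) by auto
next
  case (fix_all AV Pj xb CS L)
  let ?xb = "fix_singles z Pj AV xb"
  have inv: "open_node xb" "AV = - dom xb" "Pj = projection (reduced P xb)"
    using fix_all assms(2) by auto
  have "- dom ?xb = {}"
    using dom_fix_singles[OF inv(1,2)] fix_all inv(3) by simp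
  then have "dom ?xb = UNIV" by blast
  then have "?xb = full x" if "x \<in> solutions z" "xb \<subseteq>\<^sub>m full x" for x
    using fix_singles_le_solution[OF inv(1,2) that] inv(3) total_le_full by simp
  then show ?thesis using fix_all assms(2) by auto
next
  case (fix_some AV Pj xb' xb CS L)
  have inv: "open_node xb" "AV = - dom xb" "Pj = projection (reduced P xb)"
    using fix_some assms(2) by auto
  have "- dom xb' = AV - singles z Pj AV"
    using dom_fix_singles[OF inv(1,2)] fix_some inv(3) by simp
  moreover have "open_node xb'"
    using calculation fix_some ran_fix_singles[OF inv(1,2)] inv(3) by (auto simp: open_node_def)
  moreover have "xb' \<subseteq>\<^sub>m full x" if "x \<in> solutions z" "xb \<subseteq>\<^sub>m full x" for x
    using fix_singles_le_solution[OF inv(1,2) that] inv(3) fix_some by simp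
  ultimately show ?thesis using fix_some assms(2) by auto
next
  case (branch AV Pj j xb CS L)
  then show ?thesis
    using assms(2) range_nonneg[of xb j _ z] solution_in_range[of xb _ z j]
    by (auto simp: finite_level_range)
next
  case (branch_last r R AV xb j CS L)
  have inv: "AV = - dom xb" "j \<in> AV" using branch_last assms(2) by auto
  then have "AV = {j}" using branch_last(4) by (metis card_1_singletonE singletonD)
  then have "dom xb = - {j}" using inv(1) by (metis double_complement)
  then have "dom (xb(j \<mapsto> r)) = UNIV" by auto
  then have "xb(j \<mapsto> r) = full x" if "xb \<subseteq>\<^sub>m full x" "x $ j = r" for x
    using total_le_full upd_le_full that by blast
  then show ?thesis using branch_last assms(2) by auto
next
  case (branch_more r R AV xb j CS L)
  then have "open_node (xb(j \<mapsto> r))" using assms(2) by (auto intro!: open_node_upd)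
  moreover have "xb(j \<mapsto> r) \<subseteq>\<^sub>m full x" if "xb \<subseteq>\<^sub>m full x" "x $ j = r" for x
    using upd_le_full that by blast
  ultimately show ?thesis using branch_more assms(2) by auto
next
  case (pop xb L CS)
  then show ?thesis using assms(2) by (auto simp: all_vars)
qed auto

lemma inspect_progress:
  assumes "inspect_inv z s" "\<forall>CS. s \<noteq> Done CS"
  shows "\<exists>s'. inspect_step P z s s'"
proof (cases s)
  case (Step1 Pj AV xb CS L)
  then have "AV \<noteq> {}" using assms(1) by (auto simp: open_node_def)
  then consider j where "j \<in> AV" "level_range z (Pj j) = {}"
    | "\<forall>j\<in>AV. level_range z (Pj j) \<noteq> {}" "singles z Pj AV \<noteq> {}" "AV - singles z Pj AV = {}"
    | "\<forall>j\<in>AV. level_range z (Pj j) \<noteq> {}" "singles z Pj AV \<noteq> {}" "AV - singles z Pj AV \<noteq> {}"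
    | j where "\<forall>j\<in>AV. level_range z (Pj j) \<noteq> {}" "singles z Pj AV = {}" "j \<in> AV"
    by blast
  then show ?thesis
    unfolding Step1 by cases (blast intro: inspect_step.intros)+
next
  case (Branch AV xb j R CS L)
  then have "card AV \<noteq> 0" using assms(1) by auto
  then consider "R = {}" | r where "r \<in> R" "card AV = 1" | r where "r \<in> R" "card AV > 1"
    by fastforce
  then show ?thesis
    unfolding Branch by cases (blast intro: inspect_step.intros)+
next
  case (Step2 CS L)
  then show ?thesis by (cases "L = {}") (blast intro: inspect_step.intros)+
next
  case (Done CS)
  then show ?thesis using assms(2) by blast
qed

text \<open>
  Equality can fail, since the same partial candidate may already be in the set.
\<close>

lemma node_weights_insert_le:
  assumes "finite L"
  shows "node_weights (insert xb L) \<le> add_mset (4 * card (- dom xb) + 2) (node_weights L)"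
  using assms by (cases "xb \<in> L") (simp_all add: node_weights_def insert_absorb)

lemma node_weights_remove:
  assumes "finite L" "xb \<in> L"
  shows "node_weights L = add_mset (4 * card (- dom xb) + 2) (node_weights (L - {xb}))"
  using assms by (simp add: node_weights_def mset_set.remove)

lemma inspect_step_decreases:
  assumes "inspect_step P z s s'" "inspect_inv z s"
  shows "inspect_weights s' < inspect_weights s"
  using assms
proof cases
  case (empty_range j AV Pj xb CS L)
  then show ?thesis by simp
next
  case (fix_all AV Pj xb CS L)
  then show ?thesis by simp
next
  case (fix_some AV Pj xb' xb CS L)
  have "card (AV - singles z Pj AV) < card AV"
    using fix_some by (intro psubset_card_mono) (auto simp: singles_def)
  then show ?thesis
    using fix_some by (simp add: add_mset_lt_left_lt)
next
  case (branch AV Pj j xb CS L)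
  then have "card AV \<noteq> 0" using assms(2) by auto
  \<comment> \<open>The weight of the inspected node pays for the loop and for any finite number of pending values.\<close>
  then have "{#4 * card AV#} + replicate_mset k (4 * card AV - 1) + add_mset 0 (node_weights L) <
      add_mset (4 * card AV + 1) (add_mset 0 (node_weights L))" for k
    by (intro smaller_replacement_less_mset) (auto split: if_splits)
  then show ?thesis using branch by (simp add: add_ac)
next
  case (branch_last r R AV xb j CS L)
  then obtain k where "card R = Suc k"
    using assms(2) card.remove[of R r] by auto
  then show ?thesis using branch_last by simp
next
  case (branch_more r R AV xb j CS L)
  then obtain k where R: "card R = Suc k"
    using assms(2) card.remove[of R r] by auto
  have L: "finite L" and j: "AV = - dom xb" "j \<in> AV"
    using branch_more assms(2) by auto
  have "- dom (xb(j \<mapsto> r)) = AV - {j}" using j by auto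
  then have child: "4 * card (- dom (xb(j \<mapsto> r))) + 2 < 4 * card AV - 1"
    using branch_more j(2) by simp
  have "node_weights (insert (xb(j \<mapsto> r)) L) \<le>
      add_mset (4 * card (- dom (xb(j \<mapsto> r))) + 2) (node_weights L)"
    by (rule node_weights_insert_le[OF L])
  also have "\<dots> < add_mset (4 * card AV - 1) (node_weights L)"
    by (rule add_mset_lt_left_lt[OF child])
  finally show ?thesis using branch_more R by simp
next
  case (branch_end AV xb j CS L)
  then show ?thesis by simp
next
  case (pop xb L CS)
  then have "node_weights L = add_mset (4 * card (- dom xb) + 2) (node_weights (L - {xb}))"
    using assms(2) by (intro node_weights_remove) auto
  then show ?thesis
    using pop by (simp add: all_vars Compl_eq_Diff_UNIV add_mset_lt_left_lt)
next
  case (finish CS)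
  then show ?thesis by simp
qed

section \<open>Descending the levels\<close>

lemma feasible_objective_in_cod:
  assumes "feasible P x"
  shows "objective P x \<in> cod P"
  using feasible_completion[OF assms, of Map.empty] objective_in_cod[OF bounded_relaxation]
  by (simp add: all_vars)

text \<open>
  Until an incumbent is found, \<open>zbest\<close> is a mere lower bound for the feasible values; afterwards it is
  the value of the incumbent.
\<close>

definition search_inv :: "int \<Rightarrow> int \<Rightarrow> (int ^ 'n) option \<Rightarrow> bool" where
  "search_inv z zbest best \<longleftrightarrow>
    Min (cod P) \<le> zbest \<and>
    (case best of None \<Rightarrow> zbest = Min (cod P) | Some x \<Rightarrow> feasible P x \<and> objective P x = zbest) \<and>
    (\<forall>x. feasible P x \<longrightarrow> objective P x \<le> z)"

definition correct :: "'n outcome \<Rightarrow> bool" where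
  "correct res \<longleftrightarrow>
    (if \<exists>x. feasible P x then \<exists>x. res = Optimal x \<and> optimal P x else res = Infeasible)"

fun main_inv :: "'n main_state \<Rightarrow> bool" where
  "main_inv Start \<longleftrightarrow> True"
| "main_inv (Loop Pj z zbest best) \<longleftrightarrow> Pj = projection P \<and> search_inv z zbest best"
| "main_inv (Inspecting Pj z zbest best s) \<longleftrightarrow>
    Pj = projection P \<and> search_inv z zbest best \<and> Min (cod P) \<le> z \<and> inspect_inv z s"
| "main_inv (Checking Pj z zbest best K) \<longleftrightarrow>
    Pj = projection P \<and> search_inv z zbest best \<and> Min (cod P) \<le> z \<and>
    finite K \<and> full ` solutions z \<subseteq> K"
| "main_inv (Return res) \<longleftrightarrow> correct res"

text \<open>
  A level is left only when no candidate remains to be examined.  Solutions of that level are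
  collected as candidates, and examining one would have ended the run, so the level had none
  and the upper bound for the feasible values drops to \<open>z - 1\<close>.
\<close>

lemma main_inv_step:
  assumes "main_step P s s'" "main_inv s"
  shows "main_inv s'"
  using assms
proof cases
  case start_empty
  then show ?thesis using feasible_objective_in_cod by (auto simp: correct_def)
next
  case start
  have "objective P x \<le> Max (cod P)" if "feasible P x" for x
    using feasible_objective_in_cod[OF that] finite_cod[of P] by simp
  then show ?thesis using start by (simp add: search_inv_def)
next
  case (call z zbest best Pj)
  then show ?thesis
    using assms(2) by (auto simp: continue_def search_inv_def inspect_inv_start)
next
  case (inspect z s s' Pj zbest best)
  then show ?thesis using assms(2) inspect_inv_step by simp
next
  case (inspected Pj z zbest best CS)
  then show ?thesis using assms(2) by auto
next
  case (check_hit xb K z Pj zbest best)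
  then show ?thesis
    using assms(2)
    by (auto simp: correct_def optimal_def feasible_candidate_def search_inv_def)
next
  case (check_improve xb K z zbest Pj best)
  then have "xb \<noteq> full x" if "x \<in> solutions z" for x
    using that by (auto simp: solutions_def)
  then show ?thesis
    using check_improve assms(2) by (auto simp: search_inv_def feasible_candidate_def)
next
  case (check_skip xb K z zbest Pj best)
  then have "xb \<noteq> full x" if "x \<in> solutions z" for x
  proof -
    have "feasible_candidate P (full x)" "objective P (point (full x)) = z"
      using that by (simp_all add: solutions_def feasible_candidate_def)
    then show ?thesis using check_skip by metis
  qed
  then show ?thesis
    using check_skip assms(2) by auto
next
  case (next_level Pj z zbest best)
  have "objective P x \<le> z - 1" if "feasible P x" for x
    using next_level assms(2) that by (force simp: search_inv_def solutions_def)
  then show ?thesis using next_level assms(2) by (simp add: search_inv_def)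
next
  case (return_best z zbest best x Pj)
  then show ?thesis
    using assms(2) by (force simp: correct_def optimal_def search_inv_def continue_def)
next
  case (return_infeasible z zbest best Pj)
  have "\<not> feasible P x" for x
  proof
    assume x: "feasible P x"
    then have "objective P x \<le> z" "z < Min (cod P)"
      using return_infeasible assms(2) by (auto simp: search_inv_def continue_def)
    moreover have "Min (cod P) \<le> objective P x"
      using feasible_objective_in_cod[OF x] finite_cod[of P] by simp
    ultimately show False by linarith
  qed
  then show ?thesis using return_infeasible by (simp add: correct_def)
qed

lemma main_inv_reachable: "(main_step P)\<^sup>*\<^sup>* Start s \<Longrightarrow> main_inv s"
  by (induction rule: rtranclp_induct) (auto intro: main_inv_step)

lemma main_progress:
  assumes "main_inv s" "\<forall>res. s \<noteq> Return res"
  shows "\<exists>s'. main_step P s s'"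
proof (cases s)
  case Start
  then show ?thesis using main_step.start_empty main_step.start by blast
next
  case (Loop Pj z zbest best)
  then show ?thesis
    by (cases "continue z zbest best"; cases best) (blast intro: main_step.intros)+
next
  case (Inspecting Pj z zbest best t)
  show ?thesis
  proof (cases "\<exists>CS. t = Done CS")
    case True
    then show ?thesis using Inspecting main_step.inspected by blast
  next
    case False
    then obtain t' where "inspect_step P z t t'"
      using inspect_progress[of z t] assms(1) Inspecting by auto
    then show ?thesis using Inspecting main_step.inspect by blast
  qed
next
  case (Checking Pj z zbest best K)
  show ?thesis
  proof (cases "K = {}")
    case True
    then show ?thesis using Checking main_step.next_level by blast
  next
    case False
    then obtain xb where "xb \<in> K" by blast
    then show ?thesis
      unfolding Checking
      using main_step.check_hit[of xb K P z Pj zbest best]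
        main_step.check_improve[of xb K P z zbest Pj best]
        main_step.check_skip[of xb K P z zbest Pj best] by blast
  qed
next
  case (Return res)
  then show ?thesis using assms(2) by blast
qed

text \<open>
  Lexicographic: the number of levels left, then the phase within the level, then the work left in
  the phase.  The levels are counted with an excess of one, so that the count still strictly decreases
  when Main leaves the lowest level.
\<close>

fun rank :: "'n main_state \<Rightarrow> nat \<times> nat \<times> nat multiset" where
  "rank Start = (nat (Max (cod P) - Min (cod P) + 1), 3, {#})"
| "rank (Loop Pj z zbest best) = (nat (z - Min (cod P) + 1), 2, {#})"
| "rank (Inspecting Pj z zbest best s) = (nat (z - Min (cod P) + 1), 1, inspect_weights s)"
| "rank (Checking Pj z zbest best K) = (nat (z - Min (cod P) + 1), 0, replicate_mset (card K) 0)"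
| "rank (Return res) = (0, 0, {#})"

definition rank_order :: "((nat \<times> nat \<times> nat multiset) \<times> (nat \<times> nat \<times> nat multiset)) set" where
  "rank_order = less_than <*lex*> less_than <*lex*> {(M, N). M < N}"

lemma wf_rank_order: "wf rank_order"
  unfolding rank_order_def by (intro wf_lex_prod wf_less_than wf)

lemma main_step_decreases:
  assumes "main_step P s s'" "main_inv s"
  shows "(rank s', rank s) \<in> rank_order"
  using assms
proof cases
  case (inspect z t t' Pj zbest best)
  then show ?thesis using assms(2) inspect_step_decreases by (simp add: rank_order_def)
next
  case (check_hit xb K z Pj zbest best)
  then show ?thesis using assms(2) by (simp add: rank_order_def)
next
  case (check_improve xb K z zbest Pj best)
  then obtain k where "card K = Suc k" using assms(2) card.remove[of K xb] by auto
  then show ?thesis using check_improve by (simp add: rank_order_def)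
next
  case (check_skip xb K z zbest Pj best)
  then obtain k where "card K = Suc k" using assms(2) card.remove[of K xb] by auto
  then show ?thesis using check_skip by (simp add: rank_order_def)
qed (use assms(2) in \<open>auto simp: rank_order_def\<close>)

lemma no_infinite_run:
  assumes "\<sigma> 0 = Start" "\<forall>k. main_step P (\<sigma> k) (\<sigma> (Suc k))"
  shows False
proof -
  have "main_inv (\<sigma> k)" for k
    by (induction k) (use assms main_inv_step in auto)
  then have "(rank (\<sigma> (Suc k)), rank (\<sigma> k)) \<in> rank_order" for k
    using assms(2) main_step_decreases by blast
  then have "\<exists>f. \<forall>k. (f (Suc k), f k) \<in> rank_order"
    by (intro exI[of _ "\<lambda>k. rank (\<sigma> k)"]) simp
  then show False
    using wf_rank_order unfolding wf_iff_no_infinite_down_chain by blast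
qed

end

theorem theorem4p3:
  fixes c :: "int ^ 'n::finite" and h :: int
    and A :: "rat ^ 'n ^ 'm::finite" and b :: "rat ^ 'm"
    and P :: "('n, 'm) pilp"
  assumes P: "P = pilp_of c h A b"
    and bounded: "bounded (relaxation P)"
  shows "\<not> (\<exists>\<sigma>. \<sigma> 0 = Start \<and> (\<forall>k::nat. main_step P (\<sigma> k) (\<sigma> (Suc k)))) \<and>
    (\<forall>s. (main_step P)\<^sup>*\<^sup>* Start s \<and> \<not> (\<exists>t. main_step P s t) \<longrightarrow>
      (\<exists>res. s = Return res \<and>
        (if \<exists>x. feasible P x then \<exists>x. res = Optimal x \<and> optimal P x else res = Infeasible)))"
proof -
  interpret bounded_pilp P
    using P bounded by unfold_locales (simp_all add: pilp_of_def)
  have "\<exists>res. s = Return res \<and> correct res"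
    if reach: "(main_step P)\<^sup>*\<^sup>* Start s" and stuck: "\<not> (\<exists>t. main_step P s t)" for s
  proof -
    have "main_inv s" using reach by (rule main_inv_reachable)
    moreover from this obtain res where "s = Return res"
      using main_progress stuck by blast
    ultimately show ?thesis by simp
  qed
  then show ?thesis
    using no_infinite_run unfolding correct_def by blast
qed

end
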